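(* Let $(A,\circ,\Delta,P,S)$ be an averaging pre-Lie bialgebra. Define $[x,y]=x\circ y-y\circ x$ and $\delta(x)=\Delta(x)-\tau(\Delta(x))$ for $x,y\in A$. Then $(A,[\cdot,\cdot],\delta,P,S)$ is an averaging Lie bialgebra if and only if the pre-Lie bialgebra $(A,\circ,\Delta)$ is balanced.
   Context: All vector spaces are finite-dimensional over a fixed field $\mathbf k$ of characteristic $0$; $\tau(x\otimes y)=y\otimes x$; Sweedler notation $\Delta(x)=x_{(1)}\otimes x_{(2)}$ (summation understood). A pre-Lie algebra $(A,\circ)$ is a vector space with a bilinear product satisfying $(x\circ y)\circ z-x\circ(y\circ z)=(y\circ x)\circ z-y\circ(x\circ z)$. Write $L_xy=x\circ y$, $R_xy=y\circ x$. An averaging operator is a linear $P:A\to A$ with $P(x)\circ P(y)=P(P(x)\circ y)=P(x\circ P(y))$; then $((A,\circ),P)$ is an averaging pre-Lie algebra. A pre-Lie coalgebra $(A,\Delta)$ satisfies $(\Delta\otimes\mathrm{id})\Delta-(\mathrm{id}\otimes\Delta)\Delta=(\tau\otimes\mathrm{id})\bigl((\Delta\otimes\mathrm{id})\Delta-(\mathrm{id}\otimes\Delta)\Delta\bigr)$. A pre-Lie bialgebra $(A,\circ,\Delta)$ is a pre-Lie algebra and pre-Lie coalgebra such that for all $x,y$: $\Delta(x\circ y-y\circ x)=(L_x\otimes\mathrm{id}+\mathrm{id}\otimes(L_x-R_x))\Delta(y)-(L_y\otimes\mathrm{id}+\mathrm{id}\otimes(L_y-R_y))\Delta(x)$ and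 $(\mathrm{id}-\tau)\Delta(x\circ y)=(\mathrm{id}-\tau)\bigl[(\mathrm{id}\otimes R_y)\Delta(x)+(L_x\otimes\mathrm{id}+\mathrm{id}\otimes L_x)\Delta(y)\bigr]$. It is balanced if $x_{(1)}\circ y\otimes x_{(2)}+y_{(2)}\otimes y_{(1)}\circ x=y_{(1)}\circ x\otimes y_{(2)}+x_{(2)}\otimes x_{(1)}\circ y$ for all $x,y\in A$. An averaging pre-Lie coalgebra $((A,\Delta),S)$ is a pre-Lie coalgebra with linear $S:A\to A$ such that $(S\otimes S)\Delta(x)=(S\otimes\mathrm{id})\Delta(S(x))=(\mathrm{id}\otimes S)\Delta(S(x))$. An averaging pre-Lie bialgebra is a quintuple $(A,\circ,\Delta,P,S)$ such that $((A,\circ),P)$ is an averaging pre-Lie algebra, $((A,\Delta),S)$ is an averaging pre-Lie coalgebra, $(A,\circ,\Delta)$ is a pre-Lie bialgebra, and for all $x,y\in A$: $P(x)\circ S(y)=S(P(x)\circ y)=S(x\circ S(y))$; $S(x)\circ P(y)=S(x\circ P(y))=S(S(x)\circ y)$; $(P\otimes S)\Delta(x)=(\mathrm{id}\otimes S)\Delta(P(x))=(P\otimes\mathrm{id})\Delta(P(x))$; $(S\otimes P)\Delta(x)=(S\otimes\mathrm{id})\Delta(P(x))=(\mathrm{id}\otimes P)\Delta(P(x))$. A Lie coalgebra $(A,\delta)$: $\delta:A\to A\otimes A$ linear with $\delta=-\tau\circ\delta$ and $(\mathrm{id}+\sigma+\sigma^2)(\mathrm{id}\otimes\delta)\delta=0$,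 $\sigma(x\otimes y\otimes z)=z\otimes x\otimes y$. A Lie bialgebra $(A,[\cdot,\cdot],\delta)$ is a Lie algebra and Lie coalgebra with $\delta([x,y])=(\mathrm{ad}_x\otimes\mathrm{id}+\mathrm{id}\otimes\mathrm{ad}_x)\delta(y)-(\mathrm{ad}_y\otimes\mathrm{id}+\mathrm{id}\otimes\mathrm{ad}_y)\delta(x)$. An averaging Lie algebra $((A,[\cdot,\cdot]),P)$: Lie algebra with linear $P$ such that $[P(x),P(y)]=P([P(x),y])=P([x,P(y)])$. An averaging Lie coalgebra $((A,\delta),S)$: Lie coalgebra with linear $S$ such that $(S\otimes S)\delta(x)=(S\otimes\mathrm{id})\delta(S(x))=(\mathrm{id}\otimes S)\delta(S(x))$. An averaging Lie bialgebra is a quintuple $(A,[\cdot,\cdot],\delta,P,S)$ such that $((A,[\cdot,\cdot]),P)$ is an averaging Lie algebra, $((A,\delta),S)$ is an averaging Lie coalgebra, $(A,[\cdot,\cdot],\delta)$ is a Lie bialgebra, and for all $x,y\in A$: $[P(x),S(y)]=S([P(x),y])=S([x,S(y)])$ and $(S\otimes P)\delta(x)=(S\otimes\mathrm{id})\delta(P(x))=(\mathrm{id}\otimes P)\delta(P(x))$. *)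

theory Defs
  imports "HOL.Vector_Spaces" "HOL-Library.Function_Algebras"
begin

section \<open>Tensor powers of a vector space\<close>

text \<open>
  A tensor in \<open>A \<otimes> A\<close> is encoded by its values on the bilinear forms on \<open>A\<close>: the pure tensor
  \<open>x \<otimes> y\<close> is the evaluation \<open>\<beta> \<mapsto> \<beta>(x, y)\<close>, and \<open>A \<otimes> A\<close> is the span of the pure tensors. A pure
  tensor is \<open>0\<close> at arguments that are not bilinear forms, so that equality of tensors is equality
  of functions. \<open>A \<otimes> A \<otimes> A\<close> is treated in the same way with trilinear forms. The universal
  properties are \<open>tensor2_universal\<close> and \<open>tensor3_universal\<close> below.
\<close>

type_synonym ('v, 'k) tensor2 = "('v \<Rightarrow> 'v \<Rightarrow> 'k) \<Rightarrow> 'k"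
type_synonym ('v, 'k) tensor3 = "('v \<Rightarrow> 'v \<Rightarrow> 'v \<Rightarrow> 'k) \<Rightarrow> 'k"

definition fun_scale :: "'k::field \<Rightarrow> ('i \<Rightarrow> 'k) \<Rightarrow> ('i \<Rightarrow> 'k)" where
  "fun_scale c t = (\<lambda>i. c * t i)"

lemma vector_space_fun_scale: "vector_space fun_scale"
  by unfold_locales (auto simp: fun_scale_def algebra_simps)

definition bilinear_map ::
  "('k::field \<Rightarrow> 'v::ab_group_add \<Rightarrow> 'v) \<Rightarrow> ('k \<Rightarrow> 'w::ab_group_add \<Rightarrow> 'w) \<Rightarrow> ('v \<Rightarrow> 'v \<Rightarrow> 'w) \<Rightarrow> bool" where
  "bilinear_map s s' f \<longleftrightarrow>
     (\<forall>x. Vector_Spaces.linear s s' (\<lambda>y. f x y)) \<and>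
     (\<forall>y. Vector_Spaces.linear s s' (\<lambda>x. f x y))"

definition trilinear_map ::
  "('k::field \<Rightarrow> 'v::ab_group_add \<Rightarrow> 'v) \<Rightarrow> ('k \<Rightarrow> 'w::ab_group_add \<Rightarrow> 'w) \<Rightarrow> ('v \<Rightarrow> 'v \<Rightarrow> 'v \<Rightarrow> 'w) \<Rightarrow> bool" where
  "trilinear_map s s' f \<longleftrightarrow>
     (\<forall>x y. Vector_Spaces.linear s s' (\<lambda>z. f x y z)) \<and>
     (\<forall>x z. Vector_Spaces.linear s s' (\<lambda>y. f x y z)) \<and>
     (\<forall>y z. Vector_Spaces.linear s s' (\<lambda>x. f x y z))"

text \<open>
  \<open>lift2 f\<close> is the linear map that sends \<open>x \<otimes> y\<close> to \<open>f x y\<close>, for bilinear \<open>f\<close> with values in a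
  space of functions, in particular in a tensor power (\<open>lift2_tens\<close>, \<open>linear_lift2\<close>). Thus
  \<open>lift2 (\<lambda>u v. f u v) (\<Delta> x)\<close> is what Sweedler notation writes as \<open>f(x\<^sub>(\<^sub>1\<^sub>), x\<^sub>(\<^sub>2\<^sub>))\<close>.
\<close>

definition lift2 :: "('v \<Rightarrow> 'v \<Rightarrow> 'i \<Rightarrow> 'k) \<Rightarrow> ('v, 'k) tensor2 \<Rightarrow> ('i \<Rightarrow> 'k)" where
  "lift2 f t = (\<lambda>i. t (\<lambda>x y. f x y i))"

definition lift3 :: "('v \<Rightarrow> 'v \<Rightarrow> 'v \<Rightarrow> 'i \<Rightarrow> 'k) \<Rightarrow> ('v, 'k) tensor3 \<Rightarrow> ('i \<Rightarrow> 'k)" where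
  "lift3 f t = (\<lambda>i. t (\<lambda>x y z. f x y z i))"

context vector_space
begin

definition tens :: "'b \<Rightarrow> 'b \<Rightarrow> ('b, 'a) tensor2" (infix "\<otimes>" 75) where
  "x \<otimes> y = (\<lambda>\<beta>. if bilinear_map scale (*) \<beta> then \<beta> x y else 0)"

definition tens3 :: "'b \<Rightarrow> 'b \<Rightarrow> 'b \<Rightarrow> ('b, 'a) tensor3" where
  "tens3 x y z = (\<lambda>\<gamma>. if trilinear_map scale (*) \<gamma> then \<gamma> x y z else 0)"

definition tensor2_space :: "('b, 'a) tensor2 set" where
  "tensor2_space = module.span fun_scale {x \<otimes> y |x y. True}"

definition tensor3_space :: "('b, 'a) tensor3 set" where
  "tensor3_space = module.span fun_scale {tens3 x y z |x y z. True}"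

definition flip :: "('b, 'a) tensor2 \<Rightarrow> ('b, 'a) tensor2" where
  "flip = lift2 (\<lambda>x y. y \<otimes> x)"

definition map2 :: "('b \<Rightarrow> 'b) \<Rightarrow> ('b \<Rightarrow> 'b) \<Rightarrow> ('b, 'a) tensor2 \<Rightarrow> ('b, 'a) tensor2" where
  "map2 f g = lift2 (\<lambda>x y. f x \<otimes> g y)"

text \<open>\<open>\<Delta> \<otimes> id\<close> and \<open>id \<otimes> \<Delta>\<close> as maps from \<open>A \<otimes> A\<close> to \<open>A \<otimes> A \<otimes> A\<close>.\<close>

definition cop_left :: "('b \<Rightarrow> ('b, 'a) tensor2) \<Rightarrow> ('b, 'a) tensor2 \<Rightarrow> ('b, 'a) tensor3" where
  "cop_left \<Delta> = lift2 (\<lambda>x y. lift2 (\<lambda>u v. tens3 u v y) (\<Delta> x))"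

definition cop_right :: "('b \<Rightarrow> ('b, 'a) tensor2) \<Rightarrow> ('b, 'a) tensor2 \<Rightarrow> ('b, 'a) tensor3" where
  "cop_right \<Delta> = lift2 (\<lambda>x y. lift2 (\<lambda>u v. tens3 x u v) (\<Delta> y))"

text \<open>\<open>\<tau> \<otimes> id\<close>.\<close>

definition flip_left :: "('b, 'a) tensor3 \<Rightarrow> ('b, 'a) tensor3" where
  "flip_left = lift3 (\<lambda>x y z. tens3 y x z)"

text \<open>The cyclic permutation \<open>\<sigma>\<close>.\<close>

definition rot :: "('b, 'a) tensor3 \<Rightarrow> ('b, 'a) tensor3" where
  "rot = lift3 (\<lambda>x y z. tens3 z x y)"

lemma vector_space_mult: "vector_space ((*) :: 'a \<Rightarrow> 'a \<Rightarrow> 'a)"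
  by unfold_locales (auto simp: algebra_simps)

lemma linear_lift2: "Vector_Spaces.linear fun_scale fun_scale (lift2 f)"
  by (auto simp: linear_iff vector_space_fun_scale lift2_def fun_scale_def plus_fun_def)

lemma linear_lift3: "Vector_Spaces.linear fun_scale fun_scale (lift3 f)"
  by (auto simp: linear_iff vector_space_fun_scale lift3_def fun_scale_def plus_fun_def)

lemma lift2_tens:
  assumes "bilinear_map scale fun_scale f"
  shows "lift2 f (x \<otimes> y) = f x y"
proof -
  have "bilinear_map scale (*) (\<lambda>x y. f x y i)" for i
    using assms vector_space_mult
    by (auto simp: bilinear_map_def linear_iff fun_scale_def)
  then show ?thesis by (simp add: lift2_def tens_def)
qed

lemma lift3_tens3:
  assumes "trilinear_map scale fun_scale f"
  shows "lift3 f (tens3 x y z) = f x y z"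
proof -
  have "trilinear_map scale (*) (\<lambda>x y z. f x y z i)" for i
    using assms vector_space_mult
    by (auto simp: trilinear_map_def linear_iff fun_scale_def)
  then show ?thesis by (simp add: lift3_def tens3_def)
qed

lemma bilinear_tens: "bilinear_map scale fun_scale (\<otimes>)"
  using vector_space_fun_scale vector_space_axioms
  by (auto simp: bilinear_map_def linear_iff tens_def fun_scale_def fun_eq_iff)

lemma trilinear_tens3: "trilinear_map scale fun_scale tens3"
  using vector_space_fun_scale vector_space_axioms
  by (auto simp: trilinear_map_def linear_iff tens3_def fun_scale_def fun_eq_iff)

lemma flip_tens: "flip (x \<otimes> y) = y \<otimes> x"
  unfolding flip_def
  by (rule lift2_tens) (use bilinear_tens in \<open>auto simp: bilinear_map_def\<close>)

lemma map2_tens: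
  assumes "Vector_Spaces.linear scale scale f" "Vector_Spaces.linear scale scale g"
  shows "map2 f g (x \<otimes> y) = f x \<otimes> g y"
  unfolding map2_def
  by (rule lift2_tens)
     (use bilinear_tens assms in \<open>auto simp: bilinear_map_def linear_iff\<close>)

lemma flip_left_tens3: "flip_left (tens3 x y z) = tens3 y x z"
  unfolding flip_left_def
  by (rule lift3_tens3) (use trilinear_tens3 in \<open>auto simp: trilinear_map_def\<close>)

lemma lift2_bilinear_param:
  fixes f :: "'c::ab_group_add \<Rightarrow> 'b \<Rightarrow> 'b \<Rightarrow> 'i \<Rightarrow> 'a"
  assumes t: "t \<in> tensor2_space"
    and bil: "\<And>c. bilinear_map scale fun_scale (f c)"
    and lin: "\<And>x y. Vector_Spaces.linear s fun_scale (\<lambda>c. f c x y)"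
  shows "Vector_Spaces.linear s fun_scale (\<lambda>c. lift2 (f c) t)"
proof -
  interpret T: vector_space "fun_scale :: 'a \<Rightarrow> ('b, 'a) tensor2 \<Rightarrow> _"
    by (rule vector_space_fun_scale)
  have s: "vector_space s"
    using lin[of 0 0] by (simp add: linear_iff)
  have zero: "lift2 g 0 = 0" for g :: "'b \<Rightarrow> 'b \<Rightarrow> 'i \<Rightarrow> 'a"
    by (simp add: lift2_def zero_fun_def)
  have add: "lift2 g (fun_scale r p + q) = fun_scale r (lift2 g p) + lift2 g q"
    for g :: "'b \<Rightarrow> 'b \<Rightarrow> 'i \<Rightarrow> 'a" and r p q
    by (simp add: lift2_def fun_scale_def plus_fun_def)
  show ?thesis
    using t unfolding tensor2_space_def
  proof (induction rule: T.span_induct_alt)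
    case base
    show ?case
      unfolding zero
      using s by (simp add: linear_iff vector_space_fun_scale) (simp add: fun_scale_def fun_eq_iff)
  next
    case (step r p q)
    then obtain x y where p: "p = x \<otimes> y" by blast
    have "Vector_Spaces.linear s fun_scale (\<lambda>c. lift2 (f c) p)"
      unfolding p lift2_tens[OF bil] by (rule lin)
    then show ?case
      unfolding add using step(2)
      by (auto simp: linear_iff fun_scale_def fun_eq_iff algebra_simps)
  qed
qed

text \<open>
  On pure tensors, \<open>cop_left \<Delta>\<close> and \<open>cop_right \<Delta>\<close> are \<open>x \<otimes> y \<mapsto> \<Delta> x \<otimes> y\<close> and \<open>x \<otimes> y \<mapsto> x \<otimes> \<Delta> y\<close>.
\<close>

lemma cop_left_tens:
  assumes \<Delta>: "Vector_Spaces.linear scale fun_scale \<Delta>" "\<And>x. \<Delta> x \<in> tensor2_space"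
  shows "cop_left \<Delta> (x \<otimes> y) = lift2 (\<lambda>u v. tens3 u v y) (\<Delta> x)"
  unfolding cop_left_def
proof (rule lift2_tens)
  have 1: "Vector_Spaces.linear scale fun_scale (\<lambda>y. lift2 (\<lambda>u v. tens3 u v y) (\<Delta> x))" for x
    using trilinear_tens3
    by (intro lift2_bilinear_param \<Delta>) (auto simp: bilinear_map_def trilinear_map_def)
  have 2: "Vector_Spaces.linear scale fun_scale (\<lambda>x. lift2 (\<lambda>u v. tens3 u v y) (\<Delta> x))" for y
    using Vector_Spaces.linear_compose[OF \<Delta>(1) linear_lift2] by (simp add: o_def)
  show "bilinear_map scale fun_scale (\<lambda>x y. lift2 (\<lambda>u v. tens3 u v y) (\<Delta> x))"
    using 1 2 by (simp add: bilinear_map_def)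
qed

lemma cop_right_tens:
  assumes \<Delta>: "Vector_Spaces.linear scale fun_scale \<Delta>" "\<And>x. \<Delta> x \<in> tensor2_space"
  shows "cop_right \<Delta> (x \<otimes> y) = lift2 (\<lambda>u v. tens3 x u v) (\<Delta> y)"
  unfolding cop_right_def
proof (rule lift2_tens)
  have 1: "Vector_Spaces.linear scale fun_scale (\<lambda>x. lift2 (\<lambda>u v. tens3 x u v) (\<Delta> y))" for y
    using trilinear_tens3
    by (intro lift2_bilinear_param \<Delta>) (auto simp: bilinear_map_def trilinear_map_def)
  have 2: "Vector_Spaces.linear scale fun_scale (\<lambda>y. lift2 (\<lambda>u v. tens3 x u v) (\<Delta> y))" for x
    using Vector_Spaces.linear_compose[OF \<Delta>(1) linear_lift2] by (simp add: o_def)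
  show "bilinear_map scale fun_scale (\<lambda>x y. lift2 (\<lambda>u v. tens3 x u v) (\<Delta> y))"
    using 1 2 by (simp add: bilinear_map_def)
qed

lemma rot_tens3: "rot (tens3 x y z) = tens3 z x y"
  unfolding rot_def
  by (rule lift3_tens3) (use trilinear_tens3 in \<open>auto simp: trilinear_map_def\<close>)

end

lemma extend_from_evaluations:
  fixes e :: "'i \<Rightarrow> 'p \<Rightarrow> 'k::field" and s :: "'k \<Rightarrow> 'w::ab_group_add \<Rightarrow> 'w" and f :: "'i \<Rightarrow> 'w"
  assumes s: "vector_space s"
    and forms: "\<And>\<psi>. Vector_Spaces.linear s (*) \<psi> \<Longrightarrow> \<exists>\<phi>. \<forall>i. e i \<phi> = \<psi> (f i)"
  shows "\<exists>F. Vector_Spaces.linear fun_scale s F \<and> (\<forall>i. F (e i) = f i)"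
proof -
  interpret W: vector_space s by fact
  interpret P: vector_space_pair fun_scale s
    using vector_space_fun_scale s by (simp add: vector_space_pair_def)
  interpret Q: vector_space_pair s "(*) :: 'k \<Rightarrow> 'k \<Rightarrow> 'k"
    using s W.vector_space_mult by (simp add: vector_space_pair_def)
  obtain B where B: "B \<subseteq> range e" "P.vs1.independent B" "range e \<subseteq> P.vs1.span B"
    using P.vs1.maximal_independent_subset by blast
  define F where "F = P.construct B (\<lambda>b. f (SOME i. e i = b))"
  have linF: "Vector_Spaces.linear fun_scale s F"
    unfolding F_def by (rule P.linear_construct) fact
  have FB: "\<exists>i. b = e i \<and> F b = f i" if "b \<in> B" for b
  proof -
    have "\<exists>i. e i = b" using B(1) that by auto
    then have "e (SOME i. e i = b) = b" by (rule someI_ex)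
    then show ?thesis
      using P.construct_basis[OF B(2) that] by (metis F_def)
  qed
  have "F (e i) = f i" for i
  proof (rule ccontr)
    assume "F (e i) \<noteq> f i"
    then have "W.independent {F (e i) - f i}" by simp
    then obtain \<psi> :: "'w \<Rightarrow> 'k"
      where lin: "Vector_Spaces.linear s (*) \<psi>" and \<psi>: "\<psi> (F (e i) - f i) = 1"
      using Q.linear_independent_extend[of "{F (e i) - f i}" "\<lambda>_. 1"] by auto
    interpret \<psi>: Vector_Spaces.linear s "(*)" \<psi> by fact
    interpret F: Vector_Spaces.linear fun_scale s F by fact
    obtain \<phi> where \<phi>: "\<And>j. e j \<phi> = \<psi> (f j)" using forms[OF lin] by blast
    have "e i \<in> P.vs1.span B" using B(3) by auto
    then have "\<psi> (F (e i)) = e i \<phi>"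
    proof (induction rule: P.vs1.span_induct_alt)
      case base
      show ?case by (simp only: F.zero \<psi>.zero) simp
    next
      case (step c b t)
      obtain j where "b = e j" "F b = f j" using FB step(1) by blast
      moreover have "\<psi> (F (fun_scale c b + t)) = c * \<psi> (F b) + \<psi> (F t)"
        by (simp only: F.add F.scale \<psi>.add \<psi>.scale)
      moreover have "(fun_scale c b + t) \<phi> = c * b \<phi> + t \<phi>"
        by (simp add: fun_scale_def)
      ultimately show ?case
        using step(2) \<phi>[of j] by (simp only:)
    qed
    then show False using \<psi> \<phi>[of i] by (simp add: \<psi>.diff)
  qed
  then show ?thesis using linF by blast
qed

context vector_space
begin

text \<open>
  Universal property of \<open>A \<otimes> A\<close>; the linear extension is a map on all functions, and it is unique
  on \<open>A \<otimes> A\<close> since the pure tensors span.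
\<close>

theorem tensor2_universal:
  assumes s: "vector_space s" and f: "bilinear_map scale s f"
  shows "\<exists>F. Vector_Spaces.linear fun_scale s F \<and> (\<forall>x y. F (x \<otimes> y) = f x y)"
    and "Vector_Spaces.linear fun_scale s F \<Longrightarrow> Vector_Spaces.linear fun_scale s G \<Longrightarrow>
         (\<And>x y. F (x \<otimes> y) = f x y) \<Longrightarrow> (\<And>x y. G (x \<otimes> y) = f x y) \<Longrightarrow>
         t \<in> tensor2_space \<Longrightarrow> F t = G t"
proof -
  have "\<exists>\<phi>. \<forall>i. (case i of (x, y) \<Rightarrow> x \<otimes> y) \<phi> = \<psi> (case i of (x, y) \<Rightarrow> f x y)"
    if "Vector_Spaces.linear s (*) \<psi>" for \<psi>
  proof -
    have "bilinear_map scale (*) (\<lambda>x y. \<psi> (f x y))"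
      using f that by (auto simp: bilinear_map_def linear_iff)
    then show ?thesis
      by (intro exI[of _ "\<lambda>x y. \<psi> (f x y)"]) (auto simp: tens_def)
  qed
  from extend_from_evaluations[OF s this]
  show "\<exists>F. Vector_Spaces.linear fun_scale s F \<and> (\<forall>x y. F (x \<otimes> y) = f x y)"
    by (auto simp: split_paired_all)
next
  assume F: "Vector_Spaces.linear fun_scale s F" and G: "Vector_Spaces.linear fun_scale s G"
    and eq: "\<And>x y. F (x \<otimes> y) = f x y" "\<And>x y. G (x \<otimes> y) = f x y" and t: "t \<in> tensor2_space"
  interpret P: vector_space_pair fun_scale s
    using vector_space_fun_scale s by (simp add: vector_space_pair_def)
  show "F t = G t"
    by (rule P.linear_eq_on[OF F G t[unfolded tensor2_space_def]]) (auto simp: eq)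
qed

theorem tensor3_universal:
  assumes s: "vector_space s" and f: "trilinear_map scale s f"
  shows "\<exists>F. Vector_Spaces.linear fun_scale s F \<and> (\<forall>x y z. F (tens3 x y z) = f x y z)"
    and "Vector_Spaces.linear fun_scale s F \<Longrightarrow> Vector_Spaces.linear fun_scale s G \<Longrightarrow>
         (\<And>x y z. F (tens3 x y z) = f x y z) \<Longrightarrow> (\<And>x y z. G (tens3 x y z) = f x y z) \<Longrightarrow>
         t \<in> tensor3_space \<Longrightarrow> F t = G t"
proof -
  have "\<exists>\<phi>. \<forall>i. (case i of (x, y, z) \<Rightarrow> tens3 x y z) \<phi> = \<psi> (case i of (x, y, z) \<Rightarrow> f x y z)"
    if "Vector_Spaces.linear s (*) \<psi>" for \<psi>
  proof -
    have "trilinear_map scale (*) (\<lambda>x y z. \<psi> (f x y z))"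
      using f that by (auto simp: trilinear_map_def linear_iff)
    then show ?thesis
      by (intro exI[of _ "\<lambda>x y z. \<psi> (f x y z)"]) (auto simp: tens3_def)
  qed
  from extend_from_evaluations[OF s this]
  show "\<exists>F. Vector_Spaces.linear fun_scale s F \<and> (\<forall>x y z. F (tens3 x y z) = f x y z)"
    by (auto simp: split_paired_all)
next
  assume F: "Vector_Spaces.linear fun_scale s F" and G: "Vector_Spaces.linear fun_scale s G"
    and eq: "\<And>x y z. F (tens3 x y z) = f x y z" "\<And>x y z. G (tens3 x y z) = f x y z"
    and t: "t \<in> tensor3_space"
  interpret P: vector_space_pair fun_scale s
    using vector_space_fun_scale s by (simp add: vector_space_pair_def)
  show "F t = G t"
    by (rule P.linear_eq_on[OF F G t[unfolded tensor3_space_def]]) (auto simp: eq)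
qed

end


section \<open>Averaging pre-Lie bialgebras\<close>

locale pre_lie_algebra = vector_space scale
  for scale :: "'k::field \<Rightarrow> 'a::ab_group_add \<Rightarrow> 'a" +
  fixes pr :: "'a \<Rightarrow> 'a \<Rightarrow> 'a" (infixl "\<cdot>" 80)
  assumes bilinear_pr: "bilinear_map scale scale pr"
    and left_symmetric: "(x \<cdot> y) \<cdot> z - x \<cdot> (y \<cdot> z) = (y \<cdot> x) \<cdot> z - y \<cdot> (x \<cdot> z)"
begin

definition L :: "'a \<Rightarrow> 'a \<Rightarrow> 'a" where "L x y = x \<cdot> y"

definition R :: "'a \<Rightarrow> 'a \<Rightarrow> 'a" where "R x y = y \<cdot> x"

end

locale averaging_pre_lie_algebra = pre_lie_algebra scale pr
  for scale :: "'k::field \<Rightarrow> 'a::ab_group_add \<Rightarrow> 'a"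
    and pr :: "'a \<Rightarrow> 'a \<Rightarrow> 'a" (infixl "\<cdot>" 80) +
  fixes P :: "'a \<Rightarrow> 'a"
  assumes linear_P: "Vector_Spaces.linear scale scale P"
    and averaging_left: "P x \<cdot> P y = P (P x \<cdot> y)"
    and averaging_right: "P x \<cdot> P y = P (x \<cdot> P y)"

locale pre_lie_coalgebra = vector_space scale
  for scale :: "'k::field \<Rightarrow> 'a::ab_group_add \<Rightarrow> 'a" +
  fixes \<Delta> :: "'a \<Rightarrow> ('a, 'k) tensor2"
  assumes linear_cop: "Vector_Spaces.linear scale fun_scale \<Delta>"
    and cop_in_tensor2: "\<Delta> x \<in> tensor2_space"
    and left_cosymmetric:
      "cop_left \<Delta> (\<Delta> x) - cop_right \<Delta> (\<Delta> x) =
       flip_left (cop_left \<Delta> (\<Delta> x) - cop_right \<Delta> (\<Delta> x))"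

locale averaging_pre_lie_coalgebra = pre_lie_coalgebra scale \<Delta>
  for scale :: "'k::field \<Rightarrow> 'a::ab_group_add \<Rightarrow> 'a" and \<Delta> :: "'a \<Rightarrow> ('a, 'k) tensor2" +
  fixes S :: "'a \<Rightarrow> 'a"
  assumes linear_S: "Vector_Spaces.linear scale scale S"
    and coaveraging_left: "map2 S S (\<Delta> x) = map2 S id (\<Delta> (S x))"
    and coaveraging_right: "map2 S S (\<Delta> x) = map2 id S (\<Delta> (S x))"

locale pre_lie_bialgebra =
  pre_lie_algebra scale pr + pre_lie_coalgebra scale \<Delta>
  for scale :: "'k::field \<Rightarrow> 'a::ab_group_add \<Rightarrow> 'a"
    and pr :: "'a \<Rightarrow> 'a \<Rightarrow> 'a" (infixl "\<cdot>" 80)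
    and \<Delta> :: "'a \<Rightarrow> ('a, 'k) tensor2" +
  assumes cop_commutator:
      "\<Delta> (x \<cdot> y - y \<cdot> x) =
         (map2 (L x) id (\<Delta> y) + map2 id (L x - R x) (\<Delta> y)) -
         (map2 (L y) id (\<Delta> x) + map2 id (L y - R y) (\<Delta> x))"
    and cop_product:
      "\<Delta> (x \<cdot> y) - flip (\<Delta> (x \<cdot> y)) =
         (let t = map2 id (R y) (\<Delta> x) + (map2 (L x) id (\<Delta> y) + map2 id (L x) (\<Delta> y))
          in t - flip t)"
begin

definition balanced :: bool where
  "balanced \<longleftrightarrow> (\<forall>x y.
     lift2 (\<lambda>x1 x2. (x1 \<cdot> y) \<otimes> x2) (\<Delta> x) + lift2 (\<lambda>y1 y2. y2 \<otimes> (y1 \<cdot> x)) (\<Delta> y) =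
     lift2 (\<lambda>y1 y2. (y1 \<cdot> x) \<otimes> y2) (\<Delta> y) + lift2 (\<lambda>x1 x2. x2 \<otimes> (x1 \<cdot> y)) (\<Delta> x))"

end

locale averaging_pre_lie_bialgebra =
  averaging_pre_lie_algebra scale pr P + averaging_pre_lie_coalgebra scale \<Delta> S +
  pre_lie_bialgebra scale pr \<Delta>
  for scale :: "'k::field \<Rightarrow> 'a::ab_group_add \<Rightarrow> 'a"
    and pr :: "'a \<Rightarrow> 'a \<Rightarrow> 'a" (infixl "\<cdot>" 80)
    and \<Delta> :: "'a \<Rightarrow> ('a, 'k) tensor2"
    and P S :: "'a \<Rightarrow> 'a" +
  assumes PS_left: "P x \<cdot> S y = S (P x \<cdot> y)"
    and PS_right: "P x \<cdot> S y = S (x \<cdot> S y)"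
    and SP_right: "S x \<cdot> P y = S (x \<cdot> P y)"
    and SP_left: "S x \<cdot> P y = S (S x \<cdot> y)"
    and co_PS_right: "map2 P S (\<Delta> x) = map2 id S (\<Delta> (P x))"
    and co_PS_left: "map2 P S (\<Delta> x) = map2 P id (\<Delta> (P x))"
    and co_SP_left: "map2 S P (\<Delta> x) = map2 S id (\<Delta> (P x))"
    and co_SP_right: "map2 S P (\<Delta> x) = map2 id P (\<Delta> (P x))"


section \<open>Averaging Lie bialgebras\<close>

locale lie_algebra = vector_space scale
  for scale :: "'k::field \<Rightarrow> 'a::ab_group_add \<Rightarrow> 'a" +
  fixes br :: "'a \<Rightarrow> 'a \<Rightarrow> 'a"
  assumes bilinear_br: "bilinear_map scale scale br"
    and alternating: "br x x = 0"
    and jacobi: "br x (br y z) + br y (br z x) + br z (br x y) = 0"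

locale averaging_lie_algebra = lie_algebra scale br
  for scale :: "'k::field \<Rightarrow> 'a::ab_group_add \<Rightarrow> 'a" and br :: "'a \<Rightarrow> 'a \<Rightarrow> 'a" +
  fixes P :: "'a \<Rightarrow> 'a"
  assumes linear_P: "Vector_Spaces.linear scale scale P"
    and averaging_left: "br (P x) (P y) = P (br (P x) y)"
    and averaging_right: "br (P x) (P y) = P (br x (P y))"

locale lie_coalgebra = vector_space scale
  for scale :: "'k::field \<Rightarrow> 'a::ab_group_add \<Rightarrow> 'a" +
  fixes \<delta> :: "'a \<Rightarrow> ('a, 'k) tensor2"
  assumes linear_cobr: "Vector_Spaces.linear scale fun_scale \<delta>"
    and cobr_in_tensor2: "\<delta> x \<in> tensor2_space"
    and coantisymmetric: "\<delta> x = - flip (\<delta> x)"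
    and cojacobi: "cop_right \<delta> (\<delta> x) + rot (cop_right \<delta> (\<delta> x)) + rot (rot (cop_right \<delta> (\<delta> x))) = 0"

locale averaging_lie_coalgebra = lie_coalgebra scale \<delta>
  for scale :: "'k::field \<Rightarrow> 'a::ab_group_add \<Rightarrow> 'a" and \<delta> :: "'a \<Rightarrow> ('a, 'k) tensor2" +
  fixes S :: "'a \<Rightarrow> 'a"
  assumes linear_S: "Vector_Spaces.linear scale scale S"
    and coaveraging_left: "map2 S S (\<delta> x) = map2 S id (\<delta> (S x))"
    and coaveraging_right: "map2 S S (\<delta> x) = map2 id S (\<delta> (S x))"

locale lie_bialgebra =
  lie_algebra scale br + lie_coalgebra scale \<delta>
  for scale :: "'k::field \<Rightarrow> 'a::ab_group_add \<Rightarrow> 'a"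
    and br :: "'a \<Rightarrow> 'a \<Rightarrow> 'a"
    and \<delta> :: "'a \<Rightarrow> ('a, 'k) tensor2" +
  assumes cocycle:
    "\<delta> (br x y) =
       (map2 (br x) id (\<delta> y) + map2 id (br x) (\<delta> y)) -
       (map2 (br y) id (\<delta> x) + map2 id (br y) (\<delta> x))"

locale averaging_lie_bialgebra =
  averaging_lie_algebra scale br P + averaging_lie_coalgebra scale \<delta> S +
  lie_bialgebra scale br \<delta>
  for scale :: "'k::field \<Rightarrow> 'a::ab_group_add \<Rightarrow> 'a"
    and br :: "'a \<Rightarrow> 'a \<Rightarrow> 'a"
    and \<delta> :: "'a \<Rightarrow> ('a, 'k) tensor2"
    and P S :: "'a \<Rightarrow> 'a" +
  assumes PS_left: "br (P x) (S y) = S (br (P x) y)"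
    and PS_right: "br (P x) (S y) = S (br x (S y))"
    and co_SP_left: "map2 S P (\<delta> x) = map2 S id (\<delta> (P x))"
    and co_SP_right: "map2 S P (\<delta> x) = map2 id P (\<delta> (P x))"

end

theory Submission
  imports Defs
begin

text \<open>
  By the compatibility of \<open>\<Delta>\<close> with commutators and \<open>L\<^sub>x - ad\<^sub>x = R\<^sub>x\<close>, the two sides of the Lie
  bialgebra cocycle condition at \<open>(x, y)\<close> differ by
  \<open>(y\<^sub>(\<^sub>1\<^sub>) \<cdot> x \<otimes> y\<^sub>(\<^sub>2\<^sub>) - y\<^sub>(\<^sub>2\<^sub>) \<otimes> y\<^sub>(\<^sub>1\<^sub>) \<cdot> x) - (x\<^sub>(\<^sub>1\<^sub>) \<cdot> y \<otimes> x\<^sub>(\<^sub>2\<^sub>) - x\<^sub>(\<^sub>2\<^sub>) \<otimes> x\<^sub>(\<^sub>1\<^sub>) \<cdot> y)\<close>,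
  which vanishes exactly when the balance condition holds at \<open>(x, y)\<close>. All other axioms pass from
  the pre-Lie to the Lie structure without any extra condition.
\<close>

section \<open>Calculus of tensors: lifts, flips and permutations\<close>

context vector_space
begin

text \<open>Uniqueness in the universal property, with the bilinear map eliminated: identities
  between linear maps on tensors reduce to pure tensors.\<close>

lemma tensor2_eqI:
  assumes s: "vector_space s"
    and F: "Vector_Spaces.linear fun_scale s F" and G: "Vector_Spaces.linear fun_scale s G"
    and eq: "\<And>x y. F (x \<otimes> y) = G (x \<otimes> y)" and t: "t \<in> tensor2_space"
  shows "F t = G t"
proof -
  interpret T: vector_space_pair fun_scale s
    using vector_space_fun_scale s by (simp add: vector_space_pair_def)
  show ?thesis
    by (rule T.linear_eq_on[OF F G t[unfolded tensor2_space_def]]) (auto simp: eq)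
qed

lemma linear_lift2_comp:
  assumes "Vector_Spaces.linear fun_scale fun_scale F"
  shows "Vector_Spaces.linear fun_scale fun_scale (\<lambda>t. F (lift2 f t))"
  using Vector_Spaces.linear_compose[OF linear_lift2 assms] by (simp add: o_def)

lemma lift2_add: "lift2 f (s + t) = lift2 f s + lift2 f t"
  by (simp add: lift2_def plus_fun_def)

lemma lift2_diff: "lift2 f (s - t) = lift2 f s - lift2 f t"
  by (simp add: lift2_def fun_diff_def)

lemma lift3_add: "lift3 f (s + t) = lift3 f s + lift3 f t"
  by (simp add: lift3_def plus_fun_def)

lemma lift3_diff: "lift3 f (s - t) = lift3 f s - lift3 f t"
  by (simp add: lift3_def fun_diff_def)

text \<open>Unfolding moves \<open>f\<close> inside the evaluation of \<open>t\<close>, where it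
  meets only pure tensors, so \<open>t\<close> may be any function. Bilinearity of \<open>f\<close>
  matters because pure tensors vanish at arguments that are not bilinear.\<close>

lemma lift2_flip:
  assumes "bilinear_map scale fun_scale f"
  shows "lift2 f (flip t) = lift2 (\<lambda>x y. f y x) t"
proof -
  have "lift2 f (flip t) = lift2 (\<lambda>x y. lift2 f (y \<otimes> x)) t"
    by (simp add: lift2_def flip_def)
  then show ?thesis by (simp add: lift2_tens[OF assms])
qed

lemma lift2_map2:
  assumes "bilinear_map scale fun_scale f"
  shows "lift2 f (map2 g h t) = lift2 (\<lambda>x y. f (g x) (h y)) t"
proof -
  have "lift2 f (map2 g h t) = lift2 (\<lambda>x y. lift2 f (g x \<otimes> h y)) t"
    by (simp add: lift2_def map2_def)
  then show ?thesis by (simp add: lift2_tens[OF assms])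
qed

lemma bilinear_flip_args: "bilinear_map scale fun_scale f \<Longrightarrow> bilinear_map scale fun_scale (\<lambda>x y. f y x)"
  by (auto simp: bilinear_map_def)

lemma flip_map2: "flip (map2 f g t) = lift2 (\<lambda>x y. g y \<otimes> f x) t"
  unfolding flip_def by (rule lift2_map2[OF bilinear_flip_args[OF bilinear_tens]])

lemma map2_flip:
  assumes "Vector_Spaces.linear scale scale f" "Vector_Spaces.linear scale scale g"
  shows "map2 f g (flip t) = flip (map2 g f t)"
proof -
  have "bilinear_map scale fun_scale (\<lambda>x y. f x \<otimes> g y)"
    using bilinear_tens assms by (auto simp: bilinear_map_def linear_iff)
  then show ?thesis unfolding map2_def[of f g] flip_map2 by (rule lift2_flip)
qed

text \<open>Membership matters: for an arbitrary function \<open>t\<close>, \<open>flip\<close>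
  loses the values at arguments that are not bilinear forms.\<close>

lemma flip_flip:
  assumes "t \<in> tensor2_space"
  shows "flip (flip t) = t"
proof -
  have "Vector_Spaces.linear fun_scale fun_scale (\<lambda>t. flip (flip t))"
    unfolding flip_def by (intro linear_lift2_comp linear_lift2)
  moreover have "Vector_Spaces.linear fun_scale fun_scale (\<lambda>t::('b, 'a) tensor2. t)"
    by (simp add: linear_iff vector_space_fun_scale)
  ultimately show ?thesis
    by (rule tensor2_eqI[OF vector_space_fun_scale]) (simp_all add: flip_tens assms)
qed

lemma flip_in_tensor2:
  assumes "t \<in> tensor2_space"
  shows "flip t \<in> tensor2_space"
proof -
  interpret T: vector_space "fun_scale :: 'a \<Rightarrow> ('b, 'a) tensor2 \<Rightarrow> _"
    by (rule vector_space_fun_scale)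
  interpret flip: Vector_Spaces.linear fun_scale fun_scale flip
    unfolding flip_def by (rule linear_lift2)
  show ?thesis
    using assms unfolding tensor2_space_def
  proof (induction rule: T.span_induct_alt)
    case base
    show ?case by (simp only: flip.zero T.span_zero)
  next
    case (step c p t)
    then obtain x y where "p = x \<otimes> y" by blast
    then have "flip p \<in> {x \<otimes> y |x y. True}" by (auto simp: flip_tens)
    then show ?case
      using step(2) by (simp only: flip.add flip.scale T.span_add T.span_scale T.span_base)
  qed
qed

lemma diff_in_tensor2: "s \<in> tensor2_space \<Longrightarrow> t \<in> tensor2_space \<Longrightarrow> s - t \<in> tensor2_space"
  unfolding tensor2_space_def
  by (rule module.span_diff) (simp_all add: module_iff_vector_space vector_space_fun_scale)

lemma rot_lift2: "rot (lift2 f t) = lift2 (\<lambda>x y. rot (f x y)) t"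
  by (simp add: rot_def lift2_def lift3_def)

lemma flip_left_lift2: "flip_left (lift2 f t) = lift2 (\<lambda>x y. flip_left (f x y)) t"
  by (simp add: flip_left_def lift2_def lift3_def)

text \<open>These rules push permutations through the lifts down to \<open>tens3\<close>, so
  identities between permuted coproducts become reorderings of three factors, with no membership in
  \<open>tensor3_space\<close> to check.\<close>

lemmas permute_cop = cop_left_def cop_right_def rot_lift2 flip_left_lift2 rot_tens3 flip_left_tens3

text \<open>Linearity in \<open>t\<close> holds by unfolding, but linearity in the map
  \<open>f\<close> comes from bilinearity of the pure tensor, hence the check on generators.\<close>

lemma map2_diff_left:
  assumes f: "Vector_Spaces.linear scale scale f" and g: "Vector_Spaces.linear scale scale g"
    and h: "Vector_Spaces.linear scale scale h" and t: "t \<in> tensor2_space"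
  shows "map2 (\<lambda>x. f x - g x) h t = map2 f h t - map2 g h t"
proof (rule tensor2_eqI[OF vector_space_fun_scale _ _ _ t])
  interpret f: Vector_Spaces.linear scale scale f by fact
  interpret g: Vector_Spaces.linear scale scale g by fact
  interpret V: vector_space_pair scale scale by unfold_locales
  interpret W: vector_space_pair "fun_scale :: 'a \<Rightarrow> ('b, 'a) tensor2 \<Rightarrow> _"
    "fun_scale :: 'a \<Rightarrow> ('b, 'a) tensor2 \<Rightarrow> _"
    using vector_space_fun_scale by (simp add: vector_space_pair_def)
  show "Vector_Spaces.linear fun_scale fun_scale (map2 (\<lambda>x. f x - g x) h)"
    unfolding map2_def by (rule linear_lift2)
  show "Vector_Spaces.linear fun_scale fun_scale (\<lambda>t. map2 f h t - map2 g h t)"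
    unfolding map2_def by (intro W.linear_compose_sub linear_lift2)
  interpret T: Vector_Spaces.linear scale fun_scale "\<lambda>x. x \<otimes> h y" for y
    using bilinear_tens by (simp add: bilinear_map_def)
  show "map2 (\<lambda>x. f x - g x) h (x \<otimes> y) = map2 f h (x \<otimes> y) - map2 g h (x \<otimes> y)" for x y
    by (simp add: map2_tens V.linear_compose_sub f g h T.diff)
qed

end

section \<open>The commutator Lie algebra\<close>

context pre_lie_algebra
begin

lemma linear_L: "Vector_Spaces.linear scale scale (L x)"
  using bilinear_pr by (simp add: L_def[abs_def] bilinear_map_def)

lemma linear_R: "Vector_Spaces.linear scale scale (R x)"
  using bilinear_pr by (simp add: R_def[abs_def] bilinear_map_def)

lemma lie_algebra_commutator: "lie_algebra scale (\<lambda>x y. x \<cdot> y - y \<cdot> x)"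
proof
  interpret V: vector_space_pair scale scale by unfold_locales
  show "bilinear_map scale scale (\<lambda>x y. x \<cdot> y - y \<cdot> x)"
    using bilinear_pr unfolding bilinear_map_def by (auto intro: V.linear_compose_sub)
  interpret l: Vector_Spaces.linear scale scale "\<lambda>y. x \<cdot> y" for x
    using bilinear_pr by (simp add: bilinear_map_def)
  interpret r: Vector_Spaces.linear scale scale "\<lambda>x. x \<cdot> y" for y
    using bilinear_pr by (simp add: bilinear_map_def)
  fix x y z
  \<comment> \<open>\<open>u\<close> is the associator antisymmetrised in its first two arguments,
    zero by left symmetry. The Jacobi sum is minus its cyclic sum.\<close>
  define u where "u a b c = ((a \<cdot> b) \<cdot> c - a \<cdot> (b \<cdot> c)) - ((b \<cdot> a) \<cdot> c - b \<cdot> (a \<cdot> c))" for a b c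
  have "x \<cdot> (y \<cdot> z - z \<cdot> y) - (y \<cdot> z - z \<cdot> y) \<cdot> x + (y \<cdot> (z \<cdot> x - x \<cdot> z) - (z \<cdot> x - x \<cdot> z) \<cdot> y) +
     (z \<cdot> (x \<cdot> y - y \<cdot> x) - (x \<cdot> y - y \<cdot> x) \<cdot> z) = - (u x y z + u y z x + u z x y)"
    by (simp add: u_def l.diff r.diff algebra_simps)
  also have "\<dots> = 0"
    using left_symmetric by (simp add: u_def)
  finally show "x \<cdot> (y \<cdot> z - z \<cdot> y) - (y \<cdot> z - z \<cdot> y) \<cdot> x +
     (y \<cdot> (z \<cdot> x - x \<cdot> z) - (z \<cdot> x - x \<cdot> z) \<cdot> y) +
     (z \<cdot> (x \<cdot> y - y \<cdot> x) - (x \<cdot> y - y \<cdot> x) \<cdot> z) = 0" .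
qed simp

end

lemma (in averaging_pre_lie_algebra) averaging_lie_algebra_commutator:
  "averaging_lie_algebra scale (\<lambda>x y. x \<cdot> y - y \<cdot> x) P"
proof -
  interpret P: Vector_Spaces.linear scale scale P by (rule linear_P)
  interpret lie_algebra scale "\<lambda>x y. x \<cdot> y - y \<cdot> x" by (rule lie_algebra_commutator)
  show ?thesis
    by unfold_locales (simp_all only: P.diff averaging_left[symmetric] averaging_right[symmetric])
qed

section \<open>The Lie coalgebra of the antisymmetrised coproduct\<close>

context pre_lie_coalgebra
begin

abbreviation cobr :: "'a \<Rightarrow> ('a, 'k) tensor2" where
  "cobr \<equiv> (\<lambda>x. \<Delta> x - flip (\<Delta> x))"

lemma linear_commutator_cop: "Vector_Spaces.linear scale fun_scale cobr"
proof -
  interpret W: vector_space_pair scale "fun_scale :: 'k \<Rightarrow> ('a, 'k) tensor2 \<Rightarrow> _"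
    using vector_space_fun_scale vector_space_axioms by (simp add: vector_space_pair_def)
  have "Vector_Spaces.linear scale fun_scale (\<lambda>x. flip (\<Delta> x))"
    using Vector_Spaces.linear_compose[OF linear_cop linear_lift2] by (simp add: o_def flip_def)
  then show ?thesis by (intro W.linear_compose_sub linear_cop)
qed

lemma commutator_cop_in_tensor2: "cobr x \<in> tensor2_space"
  by (intro diff_in_tensor2 flip_in_tensor2 cop_in_tensor2)

text \<open>Both sides send \<open>x \<otimes> y\<close> to \<open>y \<otimes> \<Delta> x\<close>:
  \<open>rot\<close> brings the last factor to the front.\<close>

lemma cop_right_flip:
  assumes "t \<in> tensor2_space"
  shows "cop_right \<Delta> (flip t) = rot (cop_left \<Delta> t)"
proof (rule tensor2_eqI[OF vector_space_fun_scale _ _ _ assms])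
  show "Vector_Spaces.linear fun_scale fun_scale (\<lambda>t. cop_right \<Delta> (flip t))"
    unfolding cop_right_def flip_def by (intro linear_lift2_comp linear_lift2)
  show "Vector_Spaces.linear fun_scale fun_scale (\<lambda>t. rot (cop_left \<Delta> t))"
    unfolding cop_left_def rot_def by (intro linear_lift2_comp linear_lift3)
  show "cop_right \<Delta> (flip (x \<otimes> y)) = rot (cop_left \<Delta> (x \<otimes> y))" for x y
    by (simp add: flip_tens cop_left_tens cop_right_tens linear_cop cop_in_tensor2 rot_lift2 rot_tens3)
qed

text \<open>\<open>\<sigma>\<^sup>2(\<tau> \<otimes> id)\<close> is \<open>id \<otimes> \<tau>\<close>.\<close>

lemma cop_right_commutator:
  assumes "t \<in> tensor2_space"
  shows "cop_right cobr t = cop_right \<Delta> t - rot (rot (flip_left (cop_right \<Delta> t)))"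
proof (rule tensor2_eqI[OF vector_space_fun_scale _ _ _ assms])
  interpret W: vector_space_pair "fun_scale :: 'k \<Rightarrow> ('a, 'k) tensor2 \<Rightarrow> _"
    "fun_scale :: 'k \<Rightarrow> ('a, 'k) tensor3 \<Rightarrow> _"
    by (simp add: vector_space_pair_def vector_space_fun_scale)
  show "Vector_Spaces.linear fun_scale fun_scale (cop_right cobr)"
    unfolding cop_right_def by (rule linear_lift2)
  show "Vector_Spaces.linear fun_scale fun_scale
      (\<lambda>t. cop_right \<Delta> t - rot (rot (flip_left (cop_right \<Delta> t))))"
    unfolding permute_cop by (intro W.linear_compose_sub linear_lift2)
  fix x y
  have bil: "bilinear_map scale fun_scale (tens3 x)"
    using trilinear_tens3 by (simp add: bilinear_map_def trilinear_map_def)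
  show "cop_right cobr (x \<otimes> y) =
      cop_right \<Delta> (x \<otimes> y) - rot (rot (flip_left (cop_right \<Delta> (x \<otimes> y))))"
    by (simp add: cop_right_tens linear_cop cop_in_tensor2 linear_commutator_cop
        commutator_cop_in_tensor2 lift2_diff lift2_flip[OF bil] rot_lift2 flip_left_lift2
        rot_tens3 flip_left_tens3)
qed

text \<open>Write \<open>F\<close> for \<open>flip_left\<close>. The iterated cobracket has the
  terms \<open>D\<close>, \<open>- C\<close>, \<open>- F D\<close>, \<open>F C\<close> up to powers
  of \<open>rot\<close>. Cyclic summation absorbs these powers and leaves the cyclic sum of
  \<open>F (C - D) - (C - D)\<close>, which is zero by left cosymmetry.\<close>

lemma lie_coalgebra_commutator: "lie_coalgebra scale cobr"
proof (intro lie_coalgebra.intro lie_coalgebra_axioms.intro vector_space_axioms)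
  show "Vector_Spaces.linear scale fun_scale cobr" by (rule linear_commutator_cop)
  show "cobr x \<in> tensor2_space" for x by (rule commutator_cop_in_tensor2)
  show "cobr x = - flip (cobr x)" for x
    using flip_flip[OF cop_in_tensor2[of x]] by (simp add: flip_def lift2_diff)
  fix x
  define C D where "C = cop_left \<Delta> (\<Delta> x)" and "D = cop_right \<Delta> (\<Delta> x)"
  note rot_diff = lift3_diff[of "\<lambda>x y z. tens3 z x y", folded rot_def]
  note flip_left_diff = lift3_diff[of "\<lambda>x y z. tens3 y x z", folded flip_left_def]
  have "cop_right cobr (cobr x) =
      (D - rot C) - rot (rot (flip_left (D - rot C)))"
    unfolding cop_right_commutator[OF commutator_cop_in_tensor2] C_def D_def
      cop_right_flip[OF cop_in_tensor2, symmetric]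
    by (simp only: cop_right_def lift2_diff)
  also have "\<dots> = D - rot C - rot (rot (flip_left D)) + rot (flip_left C)"
  proof -
    \<comment> \<open>A transposition conjugates the 3-cycle to its inverse, and the cube of
      \<open>rot\<close> acts trivially here.\<close>
    have "rot (rot (flip_left (rot C))) = rot (flip_left C)"
      unfolding C_def permute_cop ..
    then show ?thesis by (simp add: rot_diff flip_left_diff)
  qed
  finally have eq: "cop_right cobr (cobr x) =
      D - rot C - rot (rot (flip_left D)) + rot (flip_left C)" .
  have r3: "rot (rot (rot C)) = C" "rot (rot (rot (flip_left C))) = flip_left C"
    "rot (rot (rot (flip_left D))) = flip_left D"
    unfolding C_def D_def permute_cop by simp_all
  have "C - D = flip_left C - flip_left D"
    using left_cosymmetric[of x] by (simp add: C_def D_def flip_left_diff)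
  \<comment> \<open>Left cosymmetry solved for \<open>C\<close>. Adding this relation and its two
    rotates \<open>rC\<close> and \<open>rrC\<close> gives exactly the cancellation in the cyclic
    sum.\<close>
  then have C: "C = D + flip_left C - flip_left D" by (simp add: algebra_simps)
  note rot_add = lift3_add[of "\<lambda>x y z. tens3 z x y", folded rot_def]
  have rC: "rot C = rot D + rot (flip_left C) - rot (flip_left D)"
    by (subst C) (simp only: rot_add rot_diff)
  have rrC: "rot (rot C) = rot (rot D) + rot (rot (flip_left C)) - rot (rot (flip_left D))"
    by (subst rC) (simp only: rot_add rot_diff)
  show "cop_right cobr (cobr x) + rot (cop_right cobr (cobr x)) +
      rot (rot (cop_right cobr (cobr x))) = 0"
    unfolding eq rot_add rot_diff r3 using C rC rrC by (simp add: algebra_simps)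
qed

text \<open>Since \<open>flip\<close> exchanges the factors, a Lie condition for
  \<open>(f, g)\<close> splits into the pre-Lie conditions for \<open>(f, g)\<close> and
  \<open>(g, f)\<close>.\<close>

lemma map2_commutator:
  assumes "Vector_Spaces.linear scale scale f" "Vector_Spaces.linear scale scale g"
  shows "map2 f g (cobr x) = map2 f g (\<Delta> x) - flip (map2 g f (\<Delta> x))"
  unfolding map2_flip[OF assms, symmetric] by (simp add: map2_def lift2_diff)

end

lemma (in averaging_pre_lie_coalgebra) averaging_lie_coalgebra_commutator:
  "averaging_lie_coalgebra scale cobr S"
proof -
  interpret S: Vector_Spaces.linear scale scale S by (rule linear_S)
  interpret lie_coalgebra scale cobr by (rule lie_coalgebra_commutator)
  show ?thesis
    by unfold_locales
      (simp_all add: S.add S.scale linear_S map2_commutator linear_id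
        coaveraging_left[symmetric] coaveraging_right[symmetric])
qed

section \<open>The cocycle condition and balance\<close>

context pre_lie_bialgebra
begin

lemma cocycle_iff_balanced_at:
  fixes x y :: 'a
  defines "ad \<equiv> \<lambda>x y. x \<cdot> y - y \<cdot> x"
  shows "cobr (ad x y) =
      (map2 (ad x) id (cobr y) + map2 id (ad x) (cobr y)) -
      (map2 (ad y) id (cobr x) + map2 id (ad y) (cobr x)) \<longleftrightarrow>
    map2 (R y) id (\<Delta> x) + flip (map2 (R x) id (\<Delta> y)) =
      map2 (R x) id (\<Delta> y) + flip (map2 (R y) id (\<Delta> x))"
proof -
  have ad: "ad z = (\<lambda>w. L z w - R z w)" for z
    by (simp add: ad_def L_def R_def)
  interpret V: vector_space_pair scale scale by unfold_locales
  have linear_ad: "Vector_Spaces.linear scale scale (ad z)" for z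
    unfolding ad by (intro V.linear_compose_sub linear_L linear_R)
  have flip_add: "flip (s + t) = flip s + flip t" for s t
    by (simp add: flip_def lift2_add)
  have flip_diff: "flip (s - t) = flip s - flip t" for s t
    by (simp add: flip_def lift2_diff)
  \<comment> \<open>In \<open>cop_commutator\<close> the second factor already carries
    \<open>ad\<close>, while the first carries \<open>L\<close>; splitting \<open>ad\<close> in the
    first factor isolates the surplus \<open>R\<close> terms.\<close>
  have ad_left: "map2 (ad z) id (\<Delta> w) = map2 (L z) id (\<Delta> w) - map2 (R z) id (\<Delta> w)" for z w
    unfolding ad by (intro map2_diff_left linear_L linear_R linear_id cop_in_tensor2)
  have "\<Delta> (ad x y) = (map2 (L x) id (\<Delta> y) + map2 id (ad x) (\<Delta> y)) -
      (map2 (L y) id (\<Delta> x) + map2 id (ad y) (\<Delta> x))"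
    using cop_commutator[of x y] by (simp add: ad ad_def fun_diff_def L_def[abs_def] R_def[abs_def])
  then show ?thesis
    by (simp add: map2_commutator linear_ad linear_id ad_left flip_add flip_diff)
      (auto simp: algebra_simps)
qed

text \<open>The Sweedler terms with exchanged factors are flips of
  \<open>map2 (R y) id (\<Delta> x)\<close> and of its counterpart with \<open>x\<close> and
  \<open>y\<close> interchanged.\<close>

lemma balanced_iff: "balanced \<longleftrightarrow> (\<forall>x y.
    map2 (R y) id (\<Delta> x) + flip (map2 (R x) id (\<Delta> y)) =
    map2 (R x) id (\<Delta> y) + flip (map2 (R y) id (\<Delta> x)))"
  by (simp add: balanced_def flip_map2) (simp add: map2_def R_def)

end

section \<open>The equivalence\<close>

theorem theorem5p9:
  fixes scale :: "'k::field_char_0 \<Rightarrow> 'a::ab_group_add \<Rightarrow> 'a"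
    and Basis :: "'a set"
    and pr :: "'a \<Rightarrow> 'a \<Rightarrow> 'a"
    and \<Delta> :: "'a \<Rightarrow> ('a, 'k) tensor2"
    and P S :: "'a \<Rightarrow> 'a"
  assumes "finite_dimensional_vector_space scale Basis"
    and "averaging_pre_lie_bialgebra scale pr \<Delta> P S"
  shows "averaging_lie_bialgebra scale
           (\<lambda>x y. pr x y - pr y x)
           (\<lambda>x. \<Delta> x - vector_space.flip scale (\<Delta> x))
           P S
         \<longleftrightarrow> pre_lie_bialgebra.balanced scale pr \<Delta>"
proof -
  interpret averaging_pre_lie_bialgebra scale pr \<Delta> P S by fact
  show ?thesis
  proof
    assume "averaging_lie_bialgebra scale (\<lambda>x y. pr x y - pr y x) cobr P S"
    then interpret lie: averaging_lie_bialgebra scale "\<lambda>x y. pr x y - pr y x" cobr P S .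
    show balanced
      unfolding balanced_iff using lie.cocycle cocycle_iff_balanced_at by blast
  next
    assume bal: balanced
    interpret lie: averaging_lie_algebra scale "\<lambda>x y. pr x y - pr y x" P
      by (rule averaging_lie_algebra_commutator)
    interpret colie: averaging_lie_coalgebra scale cobr S
      by (rule averaging_lie_coalgebra_commutator)
    interpret S: Vector_Spaces.linear scale scale S by (rule linear_S)
    show "averaging_lie_bialgebra scale (\<lambda>x y. pr x y - pr y x) cobr P S"
    proof unfold_locales
      fix x y
      show "cobr (pr x y - pr y x) =
        map2 (\<lambda>z. pr x z - pr z x) id (cobr y) + map2 id (\<lambda>z. pr x z - pr z x) (cobr y) -
        (map2 (\<lambda>z. pr y z - pr z y) id (cobr x) + map2 id (\<lambda>z. pr y z - pr z y) (cobr x))"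
        using bal cocycle_iff_balanced_at unfolding balanced_iff by blast
      \<comment> \<open>The two products in the bracket need one condition each:
        \<open>PS_left\<close> for the first, \<open>SP_right\<close> with \<open>x\<close> and
        \<open>y\<close> interchanged for the second.\<close>
      show "pr (P x) (S y) - pr (S y) (P x) = S (pr (P x) y - pr y (P x))"
        by (simp only: S.diff PS_left SP_right)
      show "pr (P x) (S y) - pr (S y) (P x) = S (pr x (S y) - pr (S y) x)"
        by (simp only: S.diff PS_right SP_left)
      \<comment> \<open>The flipped half of \<open>cobr\<close> carries \<open>P\<close> and
        \<open>S\<close> in the opposite order, so a \<open>co_PS\<close> condition joins the
        \<open>co_SP\<close> one.\<close>
      show "map2 S P (cobr x) = map2 S id (cobr (P x))"
        by (simp add: map2_commutator linear_S linear_P linear_id co_SP_left co_PS_right)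
      show "map2 S P (cobr x) = map2 id P (cobr (P x))"
        by (simp add: map2_commutator linear_S linear_P linear_id co_SP_right co_PS_left)
    qed
  qed
qed

end
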